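(* (Soundness of CPRHL.) If there is a CPRHL-proof of a partial reverse Hoare triple $\{P\}\,C\,\{Q\}$, then $\{P\}\,C\,\{Q\}$ is valid.
   Context: States $\sigma:\mathrm{Var}\to\mathbb{N}$; expressions $E ::= x\mid n\mid f(E,\dots,E)$; Boolean conditions $B ::= Q(E,\dots,E)\mid E=E\mid E\le E\mid\neg B\mid B\wedge B\mid B\vee B$; programs $C ::= \varepsilon\mid C'$, $C' ::= x:=E\mid C';C'\mid\mathtt{while}\ B\ \mathtt{do}\ C\mid C\ \mathtt{or}\ C$ ($\varepsilon$ the empty program; $C_0;C_1$ denotes $C_i$ when $C_{1-i}=\varepsilon$); assertions are first-order formulas over Boolean conditions interpreted over $\mathbb{N}$; $P\models Q$ is semantic entailment; $P[x:=E]$ is substitution. Small-step semantics: $\langle x:=E,\sigma\rangle\to\langle\varepsilon,\sigma[x\mapsto[\![E]\!]\sigma]\rangle$; $\langle\mathtt{while}\ B\ \mathtt{do}\ C,\sigma\rangle\to\langle C;\mathtt{while}\ B\ \mathtt{do}\ C,\sigma\rangle$ if $B$ holds in $\sigma$, else $\to\langle\varepsilon,\sigma\rangle$; $\langle C_0;C_1,\sigma\rangle\to\langle C_0';C_1,\sigma'\rangle$ if $\langle C_0,\sigma\rangle\to\langle C_0',\sigma'\rangle$; $\langle C_0\ \mathtt{or}\ C_1,\sigma\rangle\to\langle C_i,\sigma\rangle$ ($i=0,1$); $\to^{*}$ the reflexive-transitive closure. A triple $\{P\}C\{Q\}$ is valid if for all $\sigma'\models Q$ and all $\sigma$ with $\langle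 C,\sigma\rangle\to^{*}\langle\varepsilon,\sigma'\rangle$, $\sigma\models P$. CPRHL rules: (Axiom) $\{Q\}\,\varepsilon\,\{Q\}$; (Cons) from $\{P'\}C\{Q'\}$ infer $\{P\}C\{Q\}$ provided $P'\models P$ and $Q\models Q'$; (Assign) from $\{P\}C\{Q\}$ infer $\{P[x:=E]\}\,x:=E;C\,\{Q\}$; (Or) from $\{P\}C_0;C\{Q\}$ and $\{P\}C_1;C\{Q\}$ infer $\{P\}\,(C_0\ \mathtt{or}\ C_1);C\,\{Q\}$; (While) from $\{\neg B\to P\}C'\{Q\}$ and $\{B\to P\}\,C;\mathtt{while}\ B\ \mathtt{do}\ C;C'\,\{Q\}$ infer $\{P\}\,\mathtt{while}\ B\ \mathtt{do}\ C;C'\,\{Q\}$. A leaf of a finite derivation tree built from these rules is open if it is not an instance of Axiom; a companion of a leaf is an inner node labelled with the same triple. A CPRHL-pre-proof is a pair $(\mathcal{D},\mathcal{L})$ of a finite derivation tree $\mathcal{D}$ and a function $\mathcal{L}$ mapping each open leaf to one of its companions; it determines a (possibly infinite) graph of paths following back-links. It is a CPRHL-proof if along every infinite path rules other than Cons are applied infinitely often. *)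

theory Defs
  imports Main "HOL-Library.Infinite_Typeclass"
begin

text \<open>
  Function and predicate symbols take argument lists, so a symbol together with a number of
  arguments plays the role of a symbol of fixed arity. Their interpretations over the natural
  numbers are the parameters \<open>I\<close> and \<open>R\<close> below. The variables \<open>'v\<close> form an arbitrary infinite
  type.
\<close>

type_synonym 'v state = "'v \<Rightarrow> nat"

datatype ('v, 'f) exp = Var 'v | Num nat | Fun 'f "('v, 'f) exp list"

datatype ('v, 'f, 'p) bexp =
    BPred 'p "('v, 'f) exp list"
  | BEq "('v, 'f) exp" "('v, 'f) exp"
  | BLe "('v, 'f) exp" "('v, 'f) exp"
  | BNot "('v, 'f, 'p) bexp"
  | BAnd "('v, 'f, 'p) bexp" "('v, 'f, 'p) bexp"
  | BOr "('v, 'f, 'p) bexp" "('v, 'f, 'p) bexp"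

text \<open>
  A program is the list of its sequential components: \<open>\<epsilon>\<close> is \<open>[]\<close> and \<open>C\<^sub>0;C\<^sub>1\<close> is \<open>C\<^sub>0 @ C\<^sub>1\<close>.
  This builds in that \<open>\<epsilon>\<close> is neutral for sequencing, and that sequencing is associative, which
  the proof rules presuppose: in \<open>C; while B do C; C'\<close> the body \<open>C\<close> may itself be a sequence, and
  a rule for its first component must be applicable to the whole.
\<close>

datatype ('v, 'f, 'p) stmt =
    Assign 'v "('v, 'f) exp"
  | While "('v, 'f, 'p) bexp" "('v, 'f, 'p) stmt list"
  | Choice "('v, 'f, 'p) stmt list" "('v, 'f, 'p) stmt list"

type_synonym ('v, 'f, 'p) prog = "('v, 'f, 'p) stmt list"

datatype ('v, 'f, 'p) fm =
    Pred 'p "('v, 'f) exp list"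
  | Eq "('v, 'f) exp" "('v, 'f) exp"
  | Le "('v, 'f) exp" "('v, 'f) exp"
  | Neg "('v, 'f, 'p) fm"
  | Conj "('v, 'f, 'p) fm" "('v, 'f, 'p) fm"
  | Disj "('v, 'f, 'p) fm" "('v, 'f, 'p) fm"
  | Imp "('v, 'f, 'p) fm" "('v, 'f, 'p) fm"
  | All 'v "('v, 'f, 'p) fm"
  | Exi 'v "('v, 'f, 'p) fm"

text \<open>The inclusion of Boolean conditions into assertions, as quantifier-free formulas.\<close>

primrec fm_of :: "('v, 'f, 'p) bexp \<Rightarrow> ('v, 'f, 'p) fm" where
  "fm_of (BPred q es) = Pred q es"
| "fm_of (BEq e1 e2) = Eq e1 e2"
| "fm_of (BLe e1 e2) = Le e1 e2"
| "fm_of (BNot b) = Neg (fm_of b)"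
| "fm_of (BAnd b1 b2) = Conj (fm_of b1) (fm_of b2)"
| "fm_of (BOr b1 b2) = Disj (fm_of b1) (fm_of b2)"


subsection \<open>Semantics of expressions and assertions\<close>

primrec eval :: "('f \<Rightarrow> nat list \<Rightarrow> nat) \<Rightarrow> ('v, 'f) exp \<Rightarrow> 'v state \<Rightarrow> nat" where
  "eval I (Var x) \<sigma> = \<sigma> x"
| "eval I (Num n) \<sigma> = n"
| "eval I (Fun f es) \<sigma> = I f (map (\<lambda>e. eval I e \<sigma>) es)"

primrec bval :: "('f \<Rightarrow> nat list \<Rightarrow> nat) \<Rightarrow> ('p \<Rightarrow> nat list \<Rightarrow> bool)
    \<Rightarrow> ('v, 'f, 'p) bexp \<Rightarrow> 'v state \<Rightarrow> bool" where
  "bval I R (BPred q es) \<sigma> = R q (map (\<lambda>e. eval I e \<sigma>) es)"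
| "bval I R (BEq e1 e2) \<sigma> = (eval I e1 \<sigma> = eval I e2 \<sigma>)"
| "bval I R (BLe e1 e2) \<sigma> = (eval I e1 \<sigma> \<le> eval I e2 \<sigma>)"
| "bval I R (BNot b) \<sigma> = (\<not> bval I R b \<sigma>)"
| "bval I R (BAnd b1 b2) \<sigma> = (bval I R b1 \<sigma> \<and> bval I R b2 \<sigma>)"
| "bval I R (BOr b1 b2) \<sigma> = (bval I R b1 \<sigma> \<or> bval I R b2 \<sigma>)"

primrec sat :: "('f \<Rightarrow> nat list \<Rightarrow> nat) \<Rightarrow> ('p \<Rightarrow> nat list \<Rightarrow> bool)
    \<Rightarrow> ('v, 'f, 'p) fm \<Rightarrow> 'v state \<Rightarrow> bool" where
  "sat I R (Pred q es) \<sigma> = R q (map (\<lambda>e. eval I e \<sigma>) es)"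
| "sat I R (Eq e1 e2) \<sigma> = (eval I e1 \<sigma> = eval I e2 \<sigma>)"
| "sat I R (Le e1 e2) \<sigma> = (eval I e1 \<sigma> \<le> eval I e2 \<sigma>)"
| "sat I R (Neg P) \<sigma> = (\<not> sat I R P \<sigma>)"
| "sat I R (Conj P Q) \<sigma> = (sat I R P \<sigma> \<and> sat I R Q \<sigma>)"
| "sat I R (Disj P Q) \<sigma> = (sat I R P \<sigma> \<or> sat I R Q \<sigma>)"
| "sat I R (Imp P Q) \<sigma> = (sat I R P \<sigma> \<longrightarrow> sat I R Q \<sigma>)"
| "sat I R (All x P) \<sigma> = (\<forall>n. sat I R P (\<sigma>(x := n)))"
| "sat I R (Exi x P) \<sigma> = (\<exists>n. sat I R P (\<sigma>(x := n)))"

definition entails :: "('f \<Rightarrow> nat list \<Rightarrow> nat) \<Rightarrow> ('p \<Rightarrow> nat list \<Rightarrow> bool)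
    \<Rightarrow> ('v, 'f, 'p) fm \<Rightarrow> ('v, 'f, 'p) fm \<Rightarrow> bool" where
  "entails I R P Q \<longleftrightarrow> (\<forall>\<sigma>. sat I R P \<sigma> \<longrightarrow> sat I R Q \<sigma>)"


subsection \<open>Capture-avoiding substitution\<close>

fun vars :: "('v, 'f) exp \<Rightarrow> 'v set" where
  "vars (Var x) = {x}"
| "vars (Num n) = {}"
| "vars (Fun f es) = (\<Union>e\<in>set es. vars e)"

primrec fv :: "('v, 'f, 'p) fm \<Rightarrow> 'v set" where
  "fv (Pred q es) = (\<Union>e\<in>set es. vars e)"
| "fv (Eq e1 e2) = vars e1 \<union> vars e2"
| "fv (Le e1 e2) = vars e1 \<union> vars e2"
| "fv (Neg P) = fv P"
| "fv (Conj P Q) = fv P \<union> fv Q"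
| "fv (Disj P Q) = fv P \<union> fv Q"
| "fv (Imp P Q) = fv P \<union> fv Q"
| "fv (All x P) = fv P - {x}"
| "fv (Exi x P) = fv P - {x}"

primrec subst_exp :: "('v \<Rightarrow> ('v, 'f) exp) \<Rightarrow> ('v, 'f) exp \<Rightarrow> ('v, 'f) exp" where
  "subst_exp s (Var x) = s x"
| "subst_exp s (Num n) = Num n"
| "subst_exp s (Fun f es) = Fun f (map (subst_exp s) es)"

text \<open>
  The name to be used for the variable bound by a quantifier with variable \<open>x\<close> and body \<open>P\<close> when
  the simultaneous substitution \<open>s\<close> is pushed under it: \<open>x\<close> itself unless that would capture a
  variable, and otherwise a fresh one, which exists since \<open>'v\<close> is infinite.
\<close>

definition bound_name ::
    "('v \<Rightarrow> ('v, 'f) exp) \<Rightarrow> 'v \<Rightarrow> ('v, 'f, 'p) fm \<Rightarrow> 'v" where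
  "bound_name s x P =
    (let V = (\<Union>z\<in>fv P - {x}. vars (s z)) in if x \<notin> V then x else (SOME y. y \<notin> V))"

primrec subst_fm ::
    "('v, 'f, 'p) fm \<Rightarrow> ('v \<Rightarrow> ('v, 'f) exp) \<Rightarrow> ('v, 'f, 'p) fm" where
  "subst_fm (Pred q es) s = Pred q (map (subst_exp s) es)"
| "subst_fm (Eq e1 e2) s = Eq (subst_exp s e1) (subst_exp s e2)"
| "subst_fm (Le e1 e2) s = Le (subst_exp s e1) (subst_exp s e2)"
| "subst_fm (Neg P) s = Neg (subst_fm P s)"
| "subst_fm (Conj P Q) s = Conj (subst_fm P s) (subst_fm Q s)"
| "subst_fm (Disj P Q) s = Disj (subst_fm P s) (subst_fm Q s)"
| "subst_fm (Imp P Q) s = Imp (subst_fm P s) (subst_fm Q s)"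
| "subst_fm (All x P) s =
    All (bound_name s x P) (subst_fm P (s(x := Var (bound_name s x P))))"
| "subst_fm (Exi x P) s =
    Exi (bound_name s x P) (subst_fm P (s(x := Var (bound_name s x P))))"

definition subst ::
    "('v, 'f, 'p) fm \<Rightarrow> 'v \<Rightarrow> ('v, 'f) exp \<Rightarrow> ('v, 'f, 'p) fm" where
  "subst P x E = subst_fm P (Var(x := E))"


subsection \<open>Small-step semantics and validity of triples\<close>

inductive step :: "('f \<Rightarrow> nat list \<Rightarrow> nat) \<Rightarrow> ('p \<Rightarrow> nat list \<Rightarrow> bool)
    \<Rightarrow> ('v, 'f, 'p) prog \<times> 'v state \<Rightarrow> ('v, 'f, 'p) prog \<times> 'v state \<Rightarrow> bool"
  for I R where
  step_assign: "step I R ([Assign x E], \<sigma>) ([], \<sigma>(x := eval I E \<sigma>))"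
| step_while_true: "bval I R B \<sigma> \<Longrightarrow> step I R ([While B C], \<sigma>) (C @ [While B C], \<sigma>)"
| step_while_false: "\<not> bval I R B \<sigma> \<Longrightarrow> step I R ([While B C], \<sigma>) ([], \<sigma>)"
| step_seq: "step I R (C0, \<sigma>) (C0', \<sigma>') \<Longrightarrow> step I R (C0 @ C1, \<sigma>) (C0' @ C1, \<sigma>')"
| step_choice0: "step I R ([Choice C0 C1], \<sigma>) (C0, \<sigma>)"
| step_choice1: "step I R ([Choice C0 C1], \<sigma>) (C1, \<sigma>)"

datatype ('v, 'f, 'p) triple =
  Triple "('v, 'f, 'p) fm" "('v, 'f, 'p) prog" "('v, 'f, 'p) fm"

fun valid :: "('f \<Rightarrow> nat list \<Rightarrow> nat) \<Rightarrow> ('p \<Rightarrow> nat list \<Rightarrow> bool)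
    \<Rightarrow> ('v, 'f, 'p) triple \<Rightarrow> bool" where
  "valid I R (Triple P C Q) \<longleftrightarrow>
    (\<forall>\<sigma>'. sat I R Q \<sigma>' \<longrightarrow> (\<forall>\<sigma>. (step I R)\<^sup>*\<^sup>* (C, \<sigma>) ([], \<sigma>') \<longrightarrow> sat I R P \<sigma>))"


subsection \<open>Derivation trees, pre-proofs and proofs\<close>

datatype rule = ConsR | AssignR | OrR | WhileR

definition is_axiom :: "('v, 'f, 'p) triple \<Rightarrow> bool" where
  "is_axiom T \<longleftrightarrow> (\<exists>Q. T = Triple Q [] Q)"

text \<open>
  \<open>rule_inst I R r Ts T\<close>: the list \<open>Ts\<close> of premises and the conclusion \<open>T\<close> form an instance of
  the rule \<open>r\<close>. Axioms are accounted for at the leaves.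
\<close>

inductive rule_inst :: "('f \<Rightarrow> nat list \<Rightarrow> nat) \<Rightarrow> ('p \<Rightarrow> nat list \<Rightarrow> bool)
    \<Rightarrow> rule \<Rightarrow> ('v::infinite, 'f, 'p) triple list \<Rightarrow> ('v, 'f, 'p) triple \<Rightarrow> bool"
  for I R where
  inst_cons:
    "\<lbrakk> entails I R P' P; entails I R Q Q' \<rbrakk> \<Longrightarrow>
     rule_inst I R ConsR [Triple P' C Q'] (Triple P C Q)"
| inst_assign:
    "rule_inst I R AssignR [Triple P C Q] (Triple (subst P x E) (Assign x E # C) Q)"
| inst_or:
    "rule_inst I R OrR [Triple P (C0 @ C) Q, Triple P (C1 @ C) Q]
       (Triple P (Choice C0 C1 # C) Q)"
| inst_while:
    "rule_inst I R WhileR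
       [Triple (Imp (Neg (fm_of B)) P) C' Q,
        Triple (Imp (fm_of B) P) (C @ While B C # C') Q]
       (Triple P (While B C # C') Q)"

datatype ('v, 'f, 'p) dtree =
    Leaf "('v, 'f, 'p) triple"
  | Node "('v, 'f, 'p) triple" rule "('v, 'f, 'p) dtree list"

fun concl :: "('v, 'f, 'p) dtree \<Rightarrow> ('v, 'f, 'p) triple" where
  "concl (Leaf T) = T"
| "concl (Node T r ts) = T"

inductive is_derivation :: "('f \<Rightarrow> nat list \<Rightarrow> nat) \<Rightarrow> ('p \<Rightarrow> nat list \<Rightarrow> bool)
    \<Rightarrow> ('v::infinite, 'f, 'p) dtree \<Rightarrow> bool"
  for I R where
  "is_derivation I R (Leaf T)"
| "\<lbrakk> rule_inst I R r (map concl ts) T; \<forall>t\<in>set ts. is_derivation I R t \<rbrakk> \<Longrightarrow>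
   is_derivation I R (Node T r ts)"

text \<open>
  A node of a derivation tree is identified by its position, the list of child indices leading to
  it from the root.
\<close>

type_synonym pos = "nat list"

fun subtree :: "('v, 'f, 'p) dtree \<Rightarrow> pos \<Rightarrow> ('v, 'f, 'p) dtree option" where
  "subtree t [] = Some t"
| "subtree (Leaf T) (i # p) = None"
| "subtree (Node T r ts) (i # p) = (if i < length ts then subtree (ts ! i) p else None)"

definition open_leaf :: "('v, 'f, 'p) dtree \<Rightarrow> pos \<Rightarrow> bool" where
  "open_leaf D p \<longleftrightarrow> (\<exists>T. subtree D p = Some (Leaf T) \<and> \<not> is_axiom T)"

text \<open>A companion need not be an ancestor of the leaf.\<close>

definition companion :: "('v, 'f, 'p) dtree \<Rightarrow> pos \<Rightarrow> pos \<Rightarrow> bool" where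
  "companion D p q \<longleftrightarrow>
    (\<exists>T r ts. subtree D p = Some (Leaf T) \<and> subtree D q = Some (Node T r ts))"

text \<open>Only the values of \<open>L\<close> at open leaves matter.\<close>

definition cprhl_pre_proof :: "('f \<Rightarrow> nat list \<Rightarrow> nat) \<Rightarrow> ('p \<Rightarrow> nat list \<Rightarrow> bool)
    \<Rightarrow> ('v::infinite, 'f, 'p) dtree \<Rightarrow> (pos \<Rightarrow> pos) \<Rightarrow> bool" where
  "cprhl_pre_proof I R D L \<longleftrightarrow>
    is_derivation I R D \<and> (\<forall>p. open_leaf D p \<longrightarrow> companion D p (L p))"

definition edge :: "('v, 'f, 'p) dtree \<Rightarrow> (pos \<Rightarrow> pos) \<Rightarrow> pos \<Rightarrow> pos \<Rightarrow> bool" where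
  "edge D L p q \<longleftrightarrow>
    (\<exists>T r ts i. subtree D p = Some (Node T r ts) \<and> i < length ts \<and> q = p @ [i])
    \<or> (open_leaf D p \<and> q = L p)"

definition infinite_path ::
    "('v, 'f, 'p) dtree \<Rightarrow> (pos \<Rightarrow> pos) \<Rightarrow> (nat \<Rightarrow> pos) \<Rightarrow> bool" where
  "infinite_path D L \<nu> \<longleftrightarrow> (\<forall>n. edge D L (\<nu> n) (\<nu> (Suc n)))"

definition cprhl_proof :: "('f \<Rightarrow> nat list \<Rightarrow> nat) \<Rightarrow> ('p \<Rightarrow> nat list \<Rightarrow> bool)
    \<Rightarrow> ('v::infinite, 'f, 'p) dtree \<Rightarrow> (pos \<Rightarrow> pos) \<Rightarrow> bool" where
  "cprhl_proof I R D L \<longleftrightarrow>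
    cprhl_pre_proof I R D L \<and>
    (\<forall>\<nu>. infinite_path D L \<nu> \<longrightarrow>
      infinite {n. \<exists>T r ts. subtree D (\<nu> n) = Some (Node T r ts) \<and> r \<noteq> ConsR})"

end

(*
  Call a node of the proof bad if its triple {P} C {Q} is violated by some run of C from a state
  outside P to a state in Q. A bad node has a bad successor (a premise, or the companion of an
  open leaf), and a violating run of the successor can be chosen to be no longer, and to be
  shorter by one step if the node carries a rule other than Cons. A bad root would therefore start
  an infinite path along which the lengths of the runs never increase but strictly decrease
  infinitely often.
*)
theory Submission
  imports Defs
begin

section \<open>Substitution\<close>

lemma finite_vars: "finite (vars e)"
  by (induction e) auto

lemma finite_fv: "finite (fv P)"
  by (induction P) (auto simp: finite_vars)

lemma eval_cong: "(\<And>x. x \<in> vars e \<Longrightarrow> \<sigma> x = \<tau> x) \<Longrightarrow> eval I e \<sigma> = eval I e \<tau>"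
proof (induction e)
  case (Fun f es)
  have "eval I e \<sigma> = eval I e \<tau>" if "e \<in> set es" for e
    using Fun that by auto
  then show ?case by (auto intro: arg_cong[where f = "I f"])
qed auto

lemma map_eval_cong:
  "(\<And>x. x \<in> (\<Union>e\<in>set es. vars e) \<Longrightarrow> \<sigma> x = \<tau> x) \<Longrightarrow>
    map (\<lambda>e. eval I e \<sigma>) es = map (\<lambda>e. eval I e \<tau>) es"
  by (auto intro!: eval_cong)

lemma sat_cong: "(\<And>x. x \<in> fv P \<Longrightarrow> \<sigma> x = \<tau> x) \<Longrightarrow> sat I R P \<sigma> = sat I R P \<tau>"
proof (induction P arbitrary: \<sigma> \<tau>)
  case (Pred q es)
  then have "map (\<lambda>e. eval I e \<sigma>) es = map (\<lambda>e. eval I e \<tau>) es"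
    by (intro map_eval_cong) simp
  then show ?case by (simp only: sat.simps)
next
  case (Eq e1 e2)
  then show ?case using eval_cong[of e1 \<sigma> \<tau> I] eval_cong[of e2 \<sigma> \<tau> I] by simp
next
  case (Le e1 e2)
  then show ?case using eval_cong[of e1 \<sigma> \<tau> I] eval_cong[of e2 \<sigma> \<tau> I] by simp
next
  case (Neg P)
  show ?case using Neg.prems Neg.IH[of \<sigma> \<tau>] by simp
next
  case (Conj P Q)
  show ?case using Conj.prems Conj.IH(1)[of \<sigma> \<tau>] Conj.IH(2)[of \<sigma> \<tau>] by simp
next
  case (Disj P Q)
  show ?case using Disj.prems Disj.IH(1)[of \<sigma> \<tau>] Disj.IH(2)[of \<sigma> \<tau>] by simp
next
  case (Imp P Q)
  show ?case using Imp.prems Imp.IH(1)[of \<sigma> \<tau>] Imp.IH(2)[of \<sigma> \<tau>] by simp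
next
  case (All x P)
  have "sat I R P (\<sigma>(x := n)) = sat I R P (\<tau>(x := n))" for n
    using All.prems by (intro All.IH) auto
  then show ?case by simp
next
  case (Exi x P)
  have "sat I R P (\<sigma>(x := n)) = sat I R P (\<tau>(x := n))" for n
    using Exi.prems by (intro Exi.IH) auto
  then show ?case by simp
qed

lemma eval_subst_exp: "eval I (subst_exp s e) \<sigma> = eval I e (\<lambda>x. eval I (s x) \<sigma>)"
proof (induction e)
  case (Fun f es)
  then show ?case by (auto simp: comp_def intro!: arg_cong[where f = "I f"])
qed auto

text \<open>If \<open>x\<close> is kept, the test in \<open>bound_name\<close> is itself the
  freshness claim. Otherwise only finitely many variables are forbidden in an infinite type, so
  \<open>SOME\<close> has a witness to choose.\<close>

lemma bound_name_fresh:
  fixes P :: "('v::infinite, 'f, 'p) fm"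
  assumes "z \<in> fv P - {x}"
  shows "bound_name s x P \<notin> vars (s z)"
proof -
  let ?V = "\<Union>z\<in>fv P - {x}. vars (s z)"
  have "finite ?V" by (simp add: finite_vars finite_fv)
  then have "\<exists>y. y \<notin> ?V" using infinite_UNIV ex_new_if_finite by blast
  then have "(SOME y. y \<notin> ?V) \<notin> ?V" by (rule someI_ex)
  then have "bound_name s x P \<notin> ?V" by (auto simp: bound_name_def Let_def)
  then show ?thesis using assms by blast
qed

text \<open>The quantifier step of the substitution lemma. By \<open>sat_cong\<close> only free
  variables of \<open>P\<close> matter: \<open>x\<close> receives \<open>n\<close> through its new
  name \<open>y\<close>, and for any other one freshness hides the update of \<open>y\<close> from
  its image under \<open>s\<close>.\<close>

lemma sat_under_binder:
  fixes P :: "('v::infinite, 'f, 'p) fm" and s :: "'v \<Rightarrow> ('v, 'f) exp"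
  assumes y: "y = bound_name s x P"
  shows "sat I R P (\<lambda>z. eval I ((s(x := Var y)) z) (\<sigma>(y := n))) =
    sat I R P ((\<lambda>z. eval I (s z) \<sigma>)(x := n))"
proof (rule sat_cong)
  fix z assume z: "z \<in> fv P"
  show "eval I ((s(x := Var y)) z) (\<sigma>(y := n)) = ((\<lambda>z. eval I (s z) \<sigma>)(x := n)) z"
  proof (cases "z = x")
    case False
    then have "y \<notin> vars (s z)" using bound_name_fresh z unfolding y by blast
    then have "eval I (s z) (\<sigma>(y := n)) = eval I (s z) \<sigma>" by (intro eval_cong) auto
    with False show ?thesis by simp
  qed simp
qed

text \<open>The induction needs arbitrary simultaneous substitutions, because passing a binder adds
  a renaming to \<open>s\<close>.\<close>

lemma sat_subst_fm:
  fixes P :: "('v::infinite, 'f, 'p) fm"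
  shows "sat I R (subst_fm P s) \<sigma> = sat I R P (\<lambda>x. eval I (s x) \<sigma>)"
proof (induction P arbitrary: s \<sigma>)
  case (All x P)
  show ?case by (simp only: subst_fm.simps sat.simps All.IH sat_under_binder[OF refl])
next
  case (Exi x P)
  show ?case by (simp only: subst_fm.simps sat.simps Exi.IH sat_under_binder[OF refl])
qed (simp_all add: eval_subst_exp comp_def)

lemma sat_subst:
  fixes P :: "('v::infinite, 'f, 'p) fm"
  shows "sat I R (subst P x E) \<sigma> = sat I R P (\<sigma>(x := eval I E \<sigma>))"
proof -
  have "(\<lambda>z. eval I ((Var(x := E)) z) \<sigma>) = \<sigma>(x := eval I E \<sigma>)" by auto
  then show ?thesis by (simp only: subst_def sat_subst_fm)
qed

lemma sat_fm_of: "sat I R (fm_of B) \<sigma> = bval I R B \<sigma>"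
  by (induction B) auto


section \<open>Runs\<close>

lemma step_nonempty: "step I R c d \<Longrightarrow> fst c \<noteq> []"
  by (induction rule: step.induct) auto

text \<open>\<open>step_seq\<close> may split a program anywhere, even with an empty second part, so
  inversion takes an induction. The part that moves is never empty and hence contains the head
  \<open>S\<close>.\<close>

lemma step_Cons:
  assumes "step I R c d" "c = (S # C, \<sigma>)"
  shows "\<exists>C0' \<sigma>'. step I R ([S], \<sigma>) (C0', \<sigma>') \<and> d = (C0' @ C, \<sigma>')"
  using assms
proof (induction arbitrary: C rule: step.induct)
  case (step_seq C0 \<tau> C0' \<tau>' C1)
  from step_nonempty[OF step_seq.hyps] step_seq.prems obtain C'
    where C0: "C0 = S # C'" and C: "C = C' @ C1" and "\<tau> = \<sigma>"
    by (cases C0) auto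
  with step_seq.IH[of C'] show ?case by auto
qed (auto intro: step.intros)

lemma step_singleton:
  assumes "step I R c d" "c = ([S], \<sigma>)"
  shows "case S of
      Assign x E \<Rightarrow> d = ([], \<sigma>(x := eval I E \<sigma>))
    | While B C \<Rightarrow> d = (if bval I R B \<sigma> then (C @ [While B C], \<sigma>) else ([], \<sigma>))
    | Choice C0 C1 \<Rightarrow> d = (C0, \<sigma>) \<or> d = (C1, \<sigma>)"
  using assms
proof (induction rule: step.induct)
  case (step_seq C0 \<tau> C0' \<tau>' C1)
  \<comment> \<open>A singleton splits only trivially, so the induction hypothesis is about the same
    step.\<close>
  then have "C0 = [S] \<and> C1 = []" using step_nonempty[OF step_seq.hyps] by (cases C0) auto
  with step_seq show ?case by (cases S; simp)
qed auto

lemma run_Nil: "(step I R ^^ n) ([], \<sigma>) ([], \<sigma>') \<Longrightarrow> \<sigma> = \<sigma>'"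
proof (cases n)
  case (Suc m)
  assume "(step I R ^^ n) ([], \<sigma>) ([], \<sigma>')"
  with Suc obtain d where "step I R ([], \<sigma>) d" by (metis relpowp_Suc_D2)
  from step_nonempty[OF this] show ?thesis by simp
qed simp

text \<open>A nonempty program still has a step to make. That step belongs to the head component,
  and it is the one by which the rules other than Cons shorten a run.\<close>

lemma run_Cons:
  assumes "(step I R ^^ n) (S # C, \<sigma>) ([], \<sigma>')"
  obtains m C0 \<tau> where "n = Suc m" "step I R ([S], \<sigma>) (C0, \<tau>)"
    "(step I R ^^ m) (C0 @ C, \<tau>) ([], \<sigma>')"
proof (cases n)
  case 0
  with assms show ?thesis by simp
next
  case (Suc m)
  with assms obtain d where d: "step I R (S # C, \<sigma>) d" "(step I R ^^ m) d ([], \<sigma>')"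
    by (metis relpowp_Suc_D2)
  from step_Cons[OF d(1) refl] d(2) Suc show ?thesis using that by auto
qed


section \<open>Violating runs\<close>

text \<open>The exact length \<open>n\<close> of the counterexample run is recorded because it is
  the quantity that descends along paths.\<close>

fun violated :: "('f \<Rightarrow> nat list \<Rightarrow> nat) \<Rightarrow> ('p \<Rightarrow> nat list \<Rightarrow> bool)
    \<Rightarrow> ('v, 'f, 'p) triple \<Rightarrow> nat \<Rightarrow> bool" where
  "violated I R (Triple P C Q) n \<longleftrightarrow>
    (\<exists>\<sigma> \<sigma>'. sat I R Q \<sigma>' \<and> (step I R ^^ n) (C, \<sigma>) ([], \<sigma>') \<and> \<not> sat I R P \<sigma>)"

lemma valid_iff_not_violated: "valid I R T \<longleftrightarrow> (\<forall>n. \<not> violated I R T n)"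
  by (cases T) (auto simp: rtranclp_power)

text \<open>A run of the empty program ends where it starts, and there the two equal assertions
  agree.\<close>

lemma not_violated_axiom: "is_axiom T \<Longrightarrow> \<not> violated I R T n"
  by (auto simp: is_axiom_def dest: run_Nil)

text \<open>Cons hands the same run to its premise. Every other rule drops the first step, and the
  way that step went selects the premise.\<close>

lemma violated_premise:
  assumes "rule_inst I R r Ts T" "violated I R T n"
  shows "\<exists>i<length Ts. \<exists>m\<le>n. violated I R (Ts ! i) m \<and> (r \<noteq> ConsR \<longrightarrow> m < n)"
proof -
  have progress: ?thesis if "i < length Ts" "n = Suc m" "violated I R (Ts ! i) m" for i m
    using that by (intro exI[of _ i]) (auto intro!: exI[of _ m])
  from assms(1) show ?thesis
  proof cases
    case (inst_cons P' P Q Q' C)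
    with assms(2) have "violated I R (Triple P' C Q') n" by (auto simp: entails_def)
    with inst_cons show ?thesis by (simp del: violated.simps) blast
  next
    case (inst_assign P C Q x E)
    with assms(2) obtain \<sigma> \<sigma>' where v: "sat I R Q \<sigma>'" "\<not> sat I R (subst P x E) \<sigma>"
      and run: "(step I R ^^ n) (Assign x E # C, \<sigma>) ([], \<sigma>')" by auto
    from run obtain m C0 \<tau> where m: "n = Suc m" "step I R ([Assign x E], \<sigma>) (C0, \<tau>)"
      "(step I R ^^ m) (C0 @ C, \<tau>) ([], \<sigma>')" by (rule run_Cons)
    \<comment> \<open>The new start is the updated state, where \<open>P\<close> fails by
      \<open>sat_subst\<close>.\<close>
    from step_singleton[OF m(2) refl] m(3) v have "violated I R (Triple P C Q) m"
      by (auto simp: sat_subst)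
    with inst_assign m(1) show ?thesis by (intro progress[of 0 m]) (simp_all del: violated.simps)
  next
    case (inst_or P C0 C Q C1)
    with assms(2) obtain \<sigma> \<sigma>' where v: "sat I R Q \<sigma>'" "\<not> sat I R P \<sigma>"
      and run: "(step I R ^^ n) (Choice C0 C1 # C, \<sigma>) ([], \<sigma>')" by auto
    from run obtain m D \<tau> where m: "n = Suc m" "step I R ([Choice C0 C1], \<sigma>) (D, \<tau>)"
      "(step I R ^^ m) (D @ C, \<tau>) ([], \<sigma>')" by (rule run_Cons)
    from step_singleton[OF m(2) refl] m(3) v
    have "violated I R (Triple P (C0 @ C) Q) m \<or> violated I R (Triple P (C1 @ C) Q) m"
      by auto
    then show ?thesis
    proof
      assume "violated I R (Triple P (C0 @ C) Q) m"
      with inst_or m(1) show ?thesis by (intro progress[of 0 m]) (simp_all del: violated.simps)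
    next
      assume "violated I R (Triple P (C1 @ C) Q) m"
      with inst_or m(1) show ?thesis by (intro progress[of 1 m]) (simp_all del: violated.simps)
    qed
  next
    case (inst_while B P C' Q C)
    with assms(2) obtain \<sigma> \<sigma>' where v: "sat I R Q \<sigma>'" "\<not> sat I R P \<sigma>"
      and run: "(step I R ^^ n) (While B C # C', \<sigma>) ([], \<sigma>')" by auto
    from run obtain m D \<tau> where m: "n = Suc m" "step I R ([While B C], \<sigma>) (D, \<tau>)"
      "(step I R ^^ m) (D @ C', \<tau>) ([], \<sigma>')" by (rule run_Cons)
    show ?thesis
    \<comment> \<open>The guard's value in the start state decides between unfolding and leaving the
      loop. The state is unchanged, so the implication guarding \<open>P\<close> has a true
      antecedent and fails together with \<open>P\<close>.\<close>
    proof (cases "bval I R B \<sigma>")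
      case True
      with step_singleton[OF m(2) refl] m(3) v
      have "violated I R (Triple (Imp (fm_of B) P) (C @ While B C # C') Q) m"
        by (auto simp: sat_fm_of)
      with inst_while m(1) show ?thesis by (intro progress[of 1 m]) (simp_all del: violated.simps)
    next
      case False
      with step_singleton[OF m(2) refl] m(3) v
      have "violated I R (Triple (Imp (Neg (fm_of B)) P) C' Q) m"
        by (auto simp: sat_fm_of)
      with inst_while m(1) show ?thesis by (intro progress[of 0 m]) (simp_all del: violated.simps)
    qed
  qed
qed


section \<open>Paths in a proof\<close>

lemma subtree_append:
  "subtree t (p @ q) = (case subtree t p of None \<Rightarrow> None | Some u \<Rightarrow> subtree u q)"
  by (induction t p rule: subtree.induct) auto

lemma is_derivation_subtree:
  "is_derivation I R t \<Longrightarrow> subtree t p = Some u \<Longrightarrow> is_derivation I R u"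
proof (induction t p rule: subtree.induct)
  case (3 T r ts i p)
  from 3(2) have "\<forall>t\<in>set ts. is_derivation I R t" by cases auto
  with 3 show ?case by (auto split: if_splits)
qed auto

definition violated_at :: "('f \<Rightarrow> nat list \<Rightarrow> nat) \<Rightarrow> ('p \<Rightarrow> nat list \<Rightarrow> bool)
    \<Rightarrow> ('v, 'f, 'p) dtree \<Rightarrow> pos \<Rightarrow> nat \<Rightarrow> bool" where
  "violated_at I R D p n \<longleftrightarrow> (\<exists>t. subtree D p = Some t \<and> violated I R (concl t) n)"

text \<open>A violated leaf is no axiom, hence open, and its companion carries the same triple and
  so the same run. At an inner node \<open>violated_premise\<close> supplies the child.\<close>

lemma violated_successor:
  assumes pre: "cprhl_pre_proof I R D L" and "violated_at I R D p n"
  shows "\<exists>q m. edge D L p q \<and> violated_at I R D q m \<and> m \<le> n \<and>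
    ((\<exists>T r ts. subtree D p = Some (Node T r ts) \<and> r \<noteq> ConsR) \<longrightarrow> m < n)"
proof -
  from assms(2) obtain t where t: "subtree D p = Some t" and v: "violated I R (concl t) n"
    by (auto simp: violated_at_def)
  show ?thesis
  proof (cases t)
    case (Leaf T)
    with t v have leaf: "open_leaf D p" by (auto simp: open_leaf_def not_violated_axiom)
    with pre have "companion D p (L p)" by (auto simp: cprhl_pre_proof_def)
    with t v Leaf have "violated_at I R D (L p) n"
      by (auto simp: companion_def violated_at_def)
    with leaf t Leaf show ?thesis by (auto simp: edge_def)
  next
    case (Node T r ts)
    from pre t have "is_derivation I R t"
      by (auto simp: cprhl_pre_proof_def intro: is_derivation_subtree)
    with Node have "rule_inst I R r (map concl ts) T" by (auto elim: is_derivation.cases)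
    from violated_premise[OF this] v Node obtain i m where i: "i < length ts" and
      m: "violated I R (concl (ts ! i)) m" "m \<le> n" "r \<noteq> ConsR \<longrightarrow> m < n"
      by fastforce
    from t Node i have "subtree D (p @ [i]) = Some (ts ! i)" by (simp add: subtree_append)
    with m(1) have "violated_at I R D (p @ [i]) m" by (auto simp: violated_at_def)
    moreover from t Node i have "edge D L p (p @ [i])" by (auto simp: edge_def)
    ultimately show ?thesis using m t Node by auto
  qed
qed

text \<open>From an index where \<open>f\<close> attains its minimum onwards the sequence is
  constant, so all strict descents lie before that index.\<close>

lemma decseq_nat_finite_descents:
  fixes f :: "nat \<Rightarrow> nat"
  assumes "\<And>n. f (Suc n) \<le> f n"
  shows "finite {n. f (Suc n) < f n}"
proof -
  \<comment> \<open>The predicate is trivially true, so any element, here \<open>undefined\<close>,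
    witnesses that it is inhabited.\<close>
  have "\<exists>N. \<forall>n. f N \<le> f n" using ex_has_least_nat[of "\<lambda>_. True" undefined f] by simp
  then obtain N where N: "\<And>n. f N \<le> f n" by blast
  have "f n \<le> f N" if "N \<le> n" for n
    using lift_Suc_antimono_le[of f N n] assms that by blast
  with N have "\<not> f (Suc n) < f n" if "N \<le> n" for n
    using that by (meson le_trans not_le)
  then have "n < N" if "f (Suc n) < f n" for n
    using that by (cases "n < N") auto
  then have "{n. f (Suc n) < f n} \<subseteq> {..<N}" by blast
  then show ?thesis by (rule finite_subset) simp
qed

theorem theorem4p4:
  fixes I :: "'f \<Rightarrow> nat list \<Rightarrow> nat"
    and R :: "'p \<Rightarrow> nat list \<Rightarrow> bool"
    and P Q :: "('v::infinite, 'f, 'p) fm"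
    and C :: "('v, 'f, 'p) prog"
  assumes "\<exists>D L. cprhl_proof I R D L \<and> concl D = Triple P C Q"
  shows "valid I R (Triple P C Q)"
proof (rule ccontr)
  assume "\<not> valid I R (Triple P C Q)"
  moreover from assms obtain D L where pr: "cprhl_proof I R D L" and "concl D = Triple P C Q"
    by blast
  ultimately obtain n0 where "violated I R (concl D) n0"
    unfolding valid_iff_not_violated by auto
  then have start: "violated_at I R D [] n0" by (simp add: violated_at_def)
  let ?progress = "\<lambda>p. \<exists>T r ts. subtree D p = Some (Node T r ts) \<and> r \<noteq> ConsR"
  have pre: "cprhl_pre_proof I R D L" using pr by (simp add: cprhl_proof_def)
  let ?next = "\<lambda>x y. edge D L (fst x) (fst y) \<and> snd y \<le> snd x \<and>
    (?progress (fst x) \<longrightarrow> snd y < snd x)"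
  \<comment> \<open>Dependent choice builds a sequence of pairs of a position and the length of a
    violating run there.\<close>
  have "\<exists>s. \<forall>k. violated_at I R D (fst (s k)) (snd (s k)) \<and> ?next (s k) (s (Suc k))"
  proof (rule dependent_nat_choice)
    show "\<exists>x. violated_at I R D (fst x) (snd x)" using start by auto
    show "\<exists>y. violated_at I R D (fst y) (snd y) \<and> ?next x y"
      if "violated_at I R D (fst x) (snd x)" for x and k :: nat
      using violated_successor[OF pre that] by (simp only: split_paired_Ex fst_conv snd_conv) blast
  qed
  then obtain s where "\<forall>k. violated_at I R D (fst (s k)) (snd (s k)) \<and> ?next (s k) (s (Suc k))"
    by (rule exE)
  then have s: "edge D L (fst (s k)) (fst (s (Suc k)))" "snd (s (Suc k)) \<le> snd (s k)"
    "?progress (fst (s k)) \<Longrightarrow> snd (s (Suc k)) < snd (s k)" for k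
    by simp_all
  from s(1) have "infinite_path D L (\<lambda>k. fst (s k))" by (simp add: infinite_path_def)
  with pr have "infinite {k. ?progress (fst (s k))}" by (simp add: cprhl_proof_def)
  \<comment> \<open>Each of the infinitely many applications of a rule other than Cons forces a
    strict descent of the run lengths.\<close>
  moreover have "{k. ?progress (fst (s k))} \<subseteq> {k. snd (s (Suc k)) < snd (s k)}"
    by (intro Collect_mono impI s(3))
  ultimately have "infinite {k. snd (s (Suc k)) < snd (s k)}"
    by (rule infinite_super[rotated])
  with decseq_nat_finite_descents[of "\<lambda>k. snd (s k)", OF s(2)] show False by (rule notE[rotated])
qed

end
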